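(* Let $K$ be a field of characteristic zero. Let $D$ be a (not necessarily finite) digroup with products $\vdash,\dashv$, distinguished bar-unit $\xi$, and inverse map $x\mapsto x^{-1}$. Let $K[D]:=\bigoplus_{x\in D}Kx$ be the free $K$-vector space with basis $D$. Extend the two products of $D$ bilinearly to maps $\vdash,\dashv:K[D]\otimes K[D]\to K[D]$. For $x\in D$, define $$\Delta(x)=x\otimes x,\qquad \varepsilon(x)=1,\qquad S(x)=x^{-1},$$ and extend $\Delta$, $\varepsilon$ and $S$ linearly to $K[D]$. Then $$\bigl(K[D],\Delta,\varepsilon,\xi,\vdash,\dashv,S\bigr)$$ is a cocommutative Hopf dialgebra.
   Context: A generalized digroup is a nonempty set $D$ with two associative binary operations $\vdash,\dashv$ satisfying $x\vdash(y\dashv z)=(x\vdash y)\dashv z$, $x\dashv(y\dashv z)=x\dashv(y\vdash z)$, $(x\vdash y)\vdash z=(x\dashv y)\vdash z$, such that there is at least one bar-unit (an element $\xi$ with $x\dashv\xi=x=\xi\vdash x$ for all $x$), and for every bar-unit $\xi$ and every $x\in D$ there are $x^{-1}_{r,\xi},x^{-1}_{l,\xi}\in D$ with $x\vdash x^{-1}_{r,\xi}=\xi$ and $x^{-1}_{l,\xi}\dashv x=\xi$. A digroup is a generalized digroup with a distinguished bar-unit $\xi$ such that every $x\in D$ admits a single inverse $x^{-1}$ satisfying $x\vdash x^{-1}=\xi=x^{-1}\dashv x$. A cocommutative Hopf dialgebra $(A,\Delta,\varepsilon,\xi,\vdash,\dashv,S)$ over $K$ consists of a cocommutative $K$-coalgebra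 $(A,\Delta,\varepsilon)$, two associative bilinear products $\vdash,\dashv:A\otimes A\to A$, an element $\xi\in A$ and a coalgebra morphism $S:A\to A$ such that for all $a,b,c\in A$ (Sweedler notation): (1) $(a\vdash b)\vdash c=(a\dashv b)\vdash c$, $a\dashv(b\dashv c)=a\dashv(b\vdash c)$, $(a\vdash b)\dashv c=a\vdash(b\dashv c)$; (2) $\xi\vdash a=a=a\dashv\xi$ and $a\vdash\xi=\xi\dashv a$; (3) $\Delta(\xi)=\xi\otimes\xi$, $\varepsilon(\xi)=1$; (4) each $\star\in\{\vdash,\dashv\}$ is a coalgebra morphism: $\Delta(a\star b)=\sum(a_{(1)}\star b_{(1)})\otimes(a_{(2)}\star b_{(2)})$ and $\varepsilon(a\star b)=\varepsilon(a)\varepsilon(b)$; (5) $\sum_{(a)}a_{(1)}\vdash S(a_{(2)})=\varepsilon(a)\xi=\sum_{(a)}S(a_{(1)})\dashv a_{(2)}$. *)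

theory Defs
  imports Complex_Main "HOL-Library.Poly_Mapping"
begin

subsection \<open>Digroups\<close>

definition bar_unit :: "('d \<Rightarrow> 'd \<Rightarrow> 'd) \<Rightarrow> ('d \<Rightarrow> 'd \<Rightarrow> 'd) \<Rightarrow> 'd \<Rightarrow> bool"
  where "bar_unit lprod rprod u \<longleftrightarrow> (\<forall>x. rprod x u = x \<and> lprod u x = x)"

locale generalized_digroup =
  fixes lprod :: "'d \<Rightarrow> 'd \<Rightarrow> 'd" (infixl "\<turnstile>" 70)
    and rprod :: "'d \<Rightarrow> 'd \<Rightarrow> 'd" (infixl "\<stileturn>" 70)
  assumes lprod_assoc: "(x \<turnstile> y) \<turnstile> z = x \<turnstile> (y \<turnstile> z)"
    and rprod_assoc: "(x \<stileturn> y) \<stileturn> z = x \<stileturn> (y \<stileturn> z)"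
    and mixed_assoc: "x \<turnstile> (y \<stileturn> z) = (x \<turnstile> y) \<stileturn> z"
    and right_bar: "x \<stileturn> (y \<stileturn> z) = x \<stileturn> (y \<turnstile> z)"
    and left_bar: "(x \<turnstile> y) \<turnstile> z = (x \<stileturn> y) \<turnstile> z"
    and bar_unit_exists: "\<exists>u. bar_unit (\<turnstile>) (\<stileturn>) u"
    and one_sided_inverses:
      "bar_unit (\<turnstile>) (\<stileturn>) u \<Longrightarrow> (\<exists>r. x \<turnstile> r = u) \<and> (\<exists>l. l \<stileturn> x = u)"

locale digroup = generalized_digroup lprod rprod
  for lprod :: "'d \<Rightarrow> 'd \<Rightarrow> 'd" (infixl "\<turnstile>" 70)
    and rprod :: "'d \<Rightarrow> 'd \<Rightarrow> 'd" (infixl "\<stileturn>" 70) +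
  fixes \<xi> :: 'd
    and inv_map :: "'d \<Rightarrow> 'd"
  assumes bar_unit_xi: "bar_unit (\<turnstile>) (\<stileturn>) \<xi>"
    and lprod_inv: "x \<turnstile> inv_map x = \<xi>"
    and rprod_inv: "inv_map x \<stileturn> x = \<xi>"
begin

text \<open>The two-sided inverse is unique, so \<open>inv_map\<close> is determined by the other data.\<close>

lemma inv_map_unique:
  assumes "x \<turnstile> y = \<xi>" and "y \<stileturn> x = \<xi>"
  shows "y = inv_map x"
proof -
  have *: "z = \<xi> \<stileturn> w" if "x \<turnstile> w = \<xi>" "z \<stileturn> x = \<xi>" for z w
  proof -
    have "z = z \<stileturn> (x \<turnstile> w)" using that bar_unit_xi by (simp add: bar_unit_def)
    also have "\<dots> = (z \<stileturn> x) \<stileturn> w" by (simp add: right_bar [symmetric] rprod_assoc)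
    finally show ?thesis using that by simp
  qed
  show ?thesis using *[of y y] *[of y "inv_map x"] *[of "inv_map x" y] assms lprod_inv rprod_inv
    by metis
qed

end


subsection \<open>Free vector spaces\<close>

text \<open>
  The free \<open>K\<close>-vector space on \<open>'x\<close> is the type \<open>'x \<Rightarrow>\<^sub>0 'k\<close> of finitely supported
  functions; the basis vector belonging to \<open>x\<close> is \<open>gen x\<close>.
\<close>

abbreviation gen :: "'x \<Rightarrow> 'x \<Rightarrow>\<^sub>0 'k::field"
  where "gen x \<equiv> Poly_Mapping.single x 1"

definition free_scale :: "'k::field \<Rightarrow> ('x \<Rightarrow>\<^sub>0 'k) \<Rightarrow> ('x \<Rightarrow>\<^sub>0 'k)"
  where "free_scale c p = Poly_Mapping.map (\<lambda>d. c * d) p"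

lemma lookup_free_scale: "Poly_Mapping.lookup (free_scale c p) x = c * Poly_Mapping.lookup p x"
  by (simp add: free_scale_def Poly_Mapping.map.rep_eq when_def)

global_interpretation free: vector_space free_scale
  by unfold_locales
    (auto intro!: poly_mapping_eqI simp: lookup_free_scale lookup_add algebra_simps)

definition linear_extension ::
    "('k::field \<Rightarrow> 'b::ab_group_add \<Rightarrow> 'b) \<Rightarrow> ('x \<Rightarrow> 'b) \<Rightarrow> ('x \<Rightarrow>\<^sub>0 'k) \<Rightarrow> 'b"
  where "linear_extension scale f p =
    (\<Sum>x\<in>Poly_Mapping.keys p. scale (Poly_Mapping.lookup p x) (f x))"

definition free_map :: "('x \<Rightarrow> 'y) \<Rightarrow> ('x \<Rightarrow>\<^sub>0 'k::field) \<Rightarrow> ('y \<Rightarrow>\<^sub>0 'k)"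
  where "free_map f = linear_extension free_scale (\<lambda>x. gen (f x))"

definition bilinear_extension ::
    "('x \<Rightarrow> 'y \<Rightarrow> 'z) \<Rightarrow> ('x \<Rightarrow>\<^sub>0 'k::field) \<Rightarrow> ('y \<Rightarrow>\<^sub>0 'k) \<Rightarrow> ('z \<Rightarrow>\<^sub>0 'k)"
  where "bilinear_extension f p q = linear_extension free_scale (\<lambda>x. free_map (f x) q) p"


subsection \<open>Tensor powers\<close>

text \<open>
  For a vector space \<open>A\<close> on the type \<open>'a\<close>, the space \<open>A \<otimes> A\<close> is the quotient of the free vector
  space on \<open>'a \<times> 'a\<close> by the subspace generated by the bilinearity relations, and
  \<open>A \<otimes> A \<otimes> A\<close> is the analogous quotient of the free vector space on \<open>'a \<times> 'a \<times> 'a\<close>.  The relations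
  are generated from \<^emph>\<open>slots\<close>: functions that insert a vector at one position of a tuple
  whose other entries are fixed.  Tensors are cosets, that is, sets of formal linear combinations
  of tuples; \<open>gen (a, b)\<close> represents \<open>a \<otimes> b\<close>.
\<close>

definition multilinear_relations ::
    "('k::field \<Rightarrow> 'a::ab_group_add \<Rightarrow> 'a) \<Rightarrow> ('a \<Rightarrow> 'x) set \<Rightarrow> ('x \<Rightarrow>\<^sub>0 'k) set"
  where "multilinear_relations scale slots =
    {gen (i (a + b)) - gen (i a) - gen (i b) | i a b. i \<in> slots} \<union>
    {gen (i (scale c a)) - free_scale c (gen (i a)) | i c a. i \<in> slots}"

definition tensor_class ::
    "('k::field \<Rightarrow> 'a::ab_group_add \<Rightarrow> 'a) \<Rightarrow> ('a \<Rightarrow> 'x) set \<Rightarrow> ('x \<Rightarrow>\<^sub>0 'k) \<Rightarrow> ('x \<Rightarrow>\<^sub>0 'k) set"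
  where "tensor_class scale slots p =
    {q. q - p \<in> free.span (multilinear_relations scale slots)}"

definition tensor2 ::
    "('k::field \<Rightarrow> 'a::ab_group_add \<Rightarrow> 'a) \<Rightarrow> ('a \<times> 'a \<Rightarrow>\<^sub>0 'k) \<Rightarrow> ('a \<times> 'a \<Rightarrow>\<^sub>0 'k) set"
  where "tensor2 scale =
    tensor_class scale (Set.range (\<lambda>b a. (a, b)) \<union> Set.range (\<lambda>a b. (a, b)))"

definition tensor3 ::
    "('k::field \<Rightarrow> 'a::ab_group_add \<Rightarrow> 'a) \<Rightarrow> ('a \<times> 'a \<times> 'a \<Rightarrow>\<^sub>0 'k)
      \<Rightarrow> ('a \<times> 'a \<times> 'a \<Rightarrow>\<^sub>0 'k) set"
  where "tensor3 scale = tensor_class scale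
    ({\<lambda>a. (a, b, c) | b c. True} \<union> {\<lambda>b. (a, b, c) | a c. True} \<union> {\<lambda>c. (a, b, c) | a b. True})"


subsection \<open>Coalgebras\<close>

text \<open>
  The value \<open>\<Delta> a\<close> is an element of \<open>A \<otimes> A\<close>, hence a nonempty coset.  An element \<open>p \<in> \<Delta> a\<close> is
  a way of writing \<open>\<Delta> a\<close> as a sum of the form \<open>\<Sum> a\<^sub>1 \<otimes> a\<^sub>2\<close>.  A Sweedler expression
  \<open>\<Sum> F a\<^sub>1 a\<^sub>2\<close> is therefore rendered as the linear extension of \<open>\<lambda>(a\<^sub>1, a\<^sub>2). F a\<^sub>1 a\<^sub>2\<close> evaluated
  at \<open>p\<close>, and an equation in Sweedler notation is required for every representative \<open>p\<close>.  In
  coassociativity, \<open>\<delta>\<close> is likewise an arbitrary choice of representatives of \<open>\<Delta>\<close>.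
\<close>

locale coalgebra = vector_space scale
  for scale :: "'k::field \<Rightarrow> 'a::ab_group_add \<Rightarrow> 'a" +
  fixes \<Delta> :: "'a \<Rightarrow> ('a \<times> 'a \<Rightarrow>\<^sub>0 'k) set"
    and \<epsilon> :: "'a \<Rightarrow> 'k"
  assumes Delta_tensor: "\<Delta> a \<in> Set.range (tensor2 scale)"
    and Delta_add: "\<lbrakk>p \<in> \<Delta> a; q \<in> \<Delta> b\<rbrakk> \<Longrightarrow> p + q \<in> \<Delta> (a + b)"
    and Delta_scale: "p \<in> \<Delta> a \<Longrightarrow> free_scale c p \<in> \<Delta> (scale c a)"
    and epsilon_linear: "Vector_Spaces.linear scale (*) \<epsilon>"
    and coassociative:
      "\<lbrakk>\<And>x. \<delta> x \<in> \<Delta> x; p \<in> \<Delta> a\<rbrakk> \<Longrightarrow>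
        tensor3 scale
          (linear_extension free_scale (\<lambda>(x, y). free_map (\<lambda>(u, v). (u, v, y)) (\<delta> x)) p) =
        tensor3 scale
          (linear_extension free_scale (\<lambda>(x, y). free_map (\<lambda>(u, v). (x, u, v)) (\<delta> y)) p)"
    and counit_left: "p \<in> \<Delta> a \<Longrightarrow> linear_extension scale (\<lambda>(x, y). scale (\<epsilon> x) y) p = a"
    and counit_right: "p \<in> \<Delta> a \<Longrightarrow> linear_extension scale (\<lambda>(x, y). scale (\<epsilon> y) x) p = a"

locale cocommutative_coalgebra = coalgebra scale \<Delta> \<epsilon>
  for scale :: "'k::field \<Rightarrow> 'a::ab_group_add \<Rightarrow> 'a" and \<Delta> and \<epsilon> +
  assumes cocommutative: "p \<in> \<Delta> a \<Longrightarrow> free_map (\<lambda>(x, y). (y, x)) p \<in> \<Delta> a"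

definition coalgebra_endomorphism ::
    "('k::field \<Rightarrow> 'a::ab_group_add \<Rightarrow> 'a) \<Rightarrow> ('a \<Rightarrow> ('a \<times> 'a \<Rightarrow>\<^sub>0 'k) set) \<Rightarrow> ('a \<Rightarrow> 'k)
      \<Rightarrow> ('a \<Rightarrow> 'a) \<Rightarrow> bool"
  where "coalgebra_endomorphism scale \<Delta> \<epsilon> f \<longleftrightarrow>
    Vector_Spaces.linear scale scale f \<and>
    (\<forall>a. \<forall>p \<in> \<Delta> a. free_map (map_prod f f) p \<in> \<Delta> (f a)) \<and>
    (\<forall>a. \<epsilon> (f a) = \<epsilon> a)"


subsection \<open>Hopf dialgebras\<close>

text \<open>
  Linear maps \<open>A \<otimes> A \<rightarrow> A\<close> are given as the corresponding bilinear maps.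
\<close>

definition bilinear_product ::
    "('k::field \<Rightarrow> 'a::ab_group_add \<Rightarrow> 'a) \<Rightarrow> ('a \<Rightarrow> 'a \<Rightarrow> 'a) \<Rightarrow> bool"
  where "bilinear_product scale m \<longleftrightarrow>
    (\<forall>a. Vector_Spaces.linear scale scale (m a)) \<and>
    (\<forall>b. Vector_Spaces.linear scale scale (\<lambda>a. m a b))"

definition coalgebra_product ::
    "('a \<Rightarrow> ('a \<times> 'a \<Rightarrow>\<^sub>0 'k::field) set) \<Rightarrow> ('a \<Rightarrow> 'k) \<Rightarrow> ('a \<Rightarrow> 'a \<Rightarrow> 'a) \<Rightarrow> bool"
  where "coalgebra_product \<Delta> \<epsilon> m \<longleftrightarrow>
    (\<forall>a b. \<forall>p \<in> \<Delta> a. \<forall>q \<in> \<Delta> b.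
      bilinear_extension (\<lambda>(a\<^sub>1, a\<^sub>2) (b\<^sub>1, b\<^sub>2). (m a\<^sub>1 b\<^sub>1, m a\<^sub>2 b\<^sub>2)) p q \<in> \<Delta> (m a b)) \<and>
    (\<forall>a b. \<epsilon> (m a b) = \<epsilon> a * \<epsilon> b)"

locale cocommutative_hopf_dialgebra = cocommutative_coalgebra scale \<Delta> \<epsilon>
  for scale :: "'k::field \<Rightarrow> 'a::ab_group_add \<Rightarrow> 'a" and \<Delta> and \<epsilon> +
  fixes \<xi> :: 'a
    and lprod :: "'a \<Rightarrow> 'a \<Rightarrow> 'a" (infixl "\<turnstile>" 70)
    and rprod :: "'a \<Rightarrow> 'a \<Rightarrow> 'a" (infixl "\<stileturn>" 70)
    and S :: "'a \<Rightarrow> 'a"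
  assumes lprod_bilinear: "bilinear_product scale (\<turnstile>)"
    and rprod_bilinear: "bilinear_product scale (\<stileturn>)"
    and lprod_assoc: "(a \<turnstile> b) \<turnstile> c = a \<turnstile> (b \<turnstile> c)"
    and rprod_assoc: "(a \<stileturn> b) \<stileturn> c = a \<stileturn> (b \<stileturn> c)"
    and S_morphism: "coalgebra_endomorphism scale \<Delta> \<epsilon> S"
    and left_bar: "(a \<turnstile> b) \<turnstile> c = (a \<stileturn> b) \<turnstile> c"
    and right_bar: "a \<stileturn> (b \<stileturn> c) = a \<stileturn> (b \<turnstile> c)"
    and mixed_assoc: "(a \<turnstile> b) \<stileturn> c = a \<turnstile> (b \<stileturn> c)"
    and xi_lprod: "\<xi> \<turnstile> a = a"
    and rprod_xi: "a \<stileturn> \<xi> = a"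
    and lprod_xi: "a \<turnstile> \<xi> = \<xi> \<stileturn> a"
    and Delta_xi: "\<Delta> \<xi> = tensor2 scale (gen (\<xi>, \<xi>))"
    and epsilon_xi: "\<epsilon> \<xi> = 1"
    and lprod_coalgebra: "coalgebra_product \<Delta> \<epsilon> (\<turnstile>)"
    and rprod_coalgebra: "coalgebra_product \<Delta> \<epsilon> (\<stileturn>)"
    and antipode_right:
      "p \<in> \<Delta> a \<Longrightarrow> linear_extension scale (\<lambda>(a\<^sub>1, a\<^sub>2). a\<^sub>1 \<turnstile> S a\<^sub>2) p = scale (\<epsilon> a) \<xi>"
    and antipode_left:
      "p \<in> \<Delta> a \<Longrightarrow> linear_extension scale (\<lambda>(a\<^sub>1, a\<^sub>2). S a\<^sub>1 \<stileturn> a\<^sub>2) p = scale (\<epsilon> a) \<xi>"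


subsection \<open>The coalgebra structure on \<open>K[D]\<close>\<close>

text \<open>
  \<open>\<Delta>\<close> is the linear extension of \<open>x \<mapsto> x \<otimes> x\<close>; as passing to classes is linear, the extension is
  computed on representatives, where \<open>gen (gen x, gen x)\<close> represents \<open>x \<otimes> x\<close> in
  \<open>K[D] \<otimes> K[D]\<close>.
\<close>

definition grouplike_Delta ::
    "('d \<Rightarrow>\<^sub>0 'k::field) \<Rightarrow> (('d \<Rightarrow>\<^sub>0 'k) \<times> ('d \<Rightarrow>\<^sub>0 'k) \<Rightarrow>\<^sub>0 'k) set"
  where "grouplike_Delta p = tensor2 free_scale (free_map (\<lambda>x. (gen x, gen x)) p)"

definition grouplike_epsilon :: "('d \<Rightarrow>\<^sub>0 'k::field) \<Rightarrow> 'k"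
  where "grouplike_epsilon = linear_extension (*) (\<lambda>x. 1)"

end

(*
  Every map on K[D] in sight is a linear extension, so an identity between composites of such maps
  reduces to the same identity on the basis D, where it is a digroup identity.  The comultiplication
  takes values in a quotient of a free space; there, a map that is bilinear modulo a subspace W
  sends the relations of the tensor square into W, so that modulo W it may be evaluated on the
  representative sum c_x (x, x) of Delta (sum c_x x).
*)

theory Submission
  imports Defs
begin

subsection \<open>Linear extensions\<close>

context vector_space
begin

text \<open>Coefficients vanish off the keys. Addition may cancel and scaling by zero may erase
  keys, so the linearity proofs need one common index set for all the sums involved.\<close>

lemma linear_extension_superset:
  assumes "finite A" "Poly_Mapping.keys p \<subseteq> A"
  shows "linear_extension scale f p = (\<Sum>x\<in>A. scale (Poly_Mapping.lookup p x) (f x))"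
  unfolding linear_extension_def
  by (rule sum.mono_neutral_left) (use assms in \<open>auto simp: in_keys_iff\<close>)

lemma linear_extension_gen [simp]: "linear_extension scale f (gen x) = f x"
  by (simp add: linear_extension_def)

lemma linear_extension_add:
  "linear_extension scale f (p + q) = linear_extension scale f p + linear_extension scale f q"
proof -
  let ?A = "Poly_Mapping.keys p \<union> Poly_Mapping.keys q"
  have "Poly_Mapping.keys (p + q) \<subseteq> ?A"
    by (rule keys_add)
  then show ?thesis
    by (simp add: linear_extension_superset[of ?A] lookup_add scale_left_distrib sum.distrib)
qed

lemma linear_extension_scale:
  "linear_extension scale f (free_scale c p) = scale c (linear_extension scale f p)"
proof -
  have "Poly_Mapping.keys (free_scale c p) \<subseteq> Poly_Mapping.keys p"
    by (auto simp: in_keys_iff lookup_free_scale)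
  then show ?thesis
    by (simp add: linear_extension_superset[of "Poly_Mapping.keys p"] lookup_free_scale
        scale_sum_right)
qed

lemma linear_linear_extension: "Vector_Spaces.linear free_scale scale (linear_extension scale f)"
  by (simp add: Vector_Spaces.linear_iff vector_space_axioms free.vector_space_axioms
      linear_extension_add linear_extension_scale)

lemma linear_extension_diff:
  "linear_extension scale f (p - q) = linear_extension scale f p - linear_extension scale f q"
  using linear_extension_add[of f "p - q" q] by simp

lemma linear_extension_add_fun:
  "linear_extension scale (\<lambda>x. f x + g x) p = linear_extension scale f p + linear_extension scale g p"
  by (simp add: linear_extension_def scale_right_distrib sum.distrib)

text \<open>Applied mostly from right to left: it folds a difference of two extensions into one
  extension, whose values can then be tested for membership in a subspace.\<close>

lemma linear_extension_diff_fun: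
  "linear_extension scale (\<lambda>x. f x - g x) p = linear_extension scale f p - linear_extension scale g p"
  by (simp add: linear_extension_def scale_right_diff_distrib sum_subtractf)

lemma linear_extension_scale_fun:
  "linear_extension scale (\<lambda>x. scale c (f x)) p = scale c (linear_extension scale f p)"
  by (simp add: linear_extension_def scale_sum_right mult.commute)

lemma linear_extension_in_subspace:
  assumes "subspace W" "\<And>x. f x \<in> W"
  shows "linear_extension scale f p \<in> W"
  unfolding linear_extension_def by (intro subspace_sum subspace_scale assms)

end

lemma linear_of_linear_extension:
  assumes "Vector_Spaces.linear s1 s2 g"
  shows "g (linear_extension s1 f p) = linear_extension s2 (\<lambda>x. g (f x)) p"
proof -
  interpret Vector_Spaces.linear s1 s2 g by fact
  show ?thesis by (simp add: linear_extension_def sum scale)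
qed

lemma linear_extension_linear_extension:
  assumes "vector_space s"
  shows "linear_extension s f (linear_extension free_scale g p) =
    linear_extension s (\<lambda>x. linear_extension s f (g x)) p"
  by (rule linear_of_linear_extension[OF vector_space.linear_linear_extension[OF assms]])

lemma linear_extension_id [simp]: "linear_extension free_scale gen p = p"
proof (rule poly_mapping_eqI)
  fix y
  have "Poly_Mapping.lookup (linear_extension free_scale gen p) y =
      (\<Sum>x\<in>Poly_Mapping.keys p. if x = y then Poly_Mapping.lookup p x else 0)"
    unfolding linear_extension_def lookup_sum
    by (rule sum.cong) (simp_all add: lookup_free_scale lookup_single when_def)
  then show "Poly_Mapping.lookup (linear_extension free_scale gen p) y = Poly_Mapping.lookup p y"
    by (simp add: in_keys_iff)
qed

text \<open>By \<open>linear_extension_id\<close>, \<open>p\<close> is the combination of basis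
  vectors with its own coefficients; the linear map \<open>g\<close> passes through that
  sum.\<close>

lemma linear_eq_linear_extension:
  assumes "Vector_Spaces.linear free_scale s g"
  shows "g p = linear_extension s (\<lambda>x. g (gen x)) p"
  using linear_of_linear_extension[OF assms, of gen p] by simp

lemma linear_free_map: "Vector_Spaces.linear free_scale free_scale (free_map f)"
  unfolding free_map_def by (rule free.linear_linear_extension)

lemma free_map_gen [simp]: "free_map f (gen x) = gen (f x)"
  by (simp add: free_map_def)

lemma vector_space_times: "vector_space ((*) :: 'k::field \<Rightarrow> 'k \<Rightarrow> 'k)"
  by unfold_locales (auto simp: algebra_simps)

section \<open>Bilinear extensions of binary operations\<close>

lemma bilinear_extension_gen_left [simp]: "bilinear_extension f (gen x) q = free_map (f x) q"
  by (simp add: bilinear_extension_def)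

lemma bilinear_extension_linear_left:
  "Vector_Spaces.linear free_scale free_scale (\<lambda>p. bilinear_extension f p q)"
  unfolding bilinear_extension_def by (rule free.linear_linear_extension)

lemma bilinear_extension_linear_right:
  "Vector_Spaces.linear free_scale free_scale (bilinear_extension f p)"
proof -
  have "linear_extension free_scale (\<lambda>x. free_map (f x) (a + b)) p =
      linear_extension free_scale (\<lambda>x. free_map (f x) a) p +
      linear_extension free_scale (\<lambda>x. free_map (f x) b) p" for a b
    by (simp add: free_map_def free.linear_extension_add free.linear_extension_add_fun)
  then show ?thesis
    by (simp add: Vector_Spaces.linear_iff free.vector_space_axioms bilinear_extension_def
        free_map_def free.linear_extension_scale free.linear_extension_scale_fun)
qed

lemma bilinear_product_bilinear_extension: "bilinear_product free_scale (bilinear_extension f)"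
  by (simp add: bilinear_product_def bilinear_extension_linear_left bilinear_extension_linear_right)

text \<open>Together with \<open>bilinear_extension_nest_right\<close> this brings both bracketings
  to an iterated sum over \<open>a\<close>, \<open>b\<close>, \<open>c\<close> in the same order, so
  that an identity on basis triples can be used by rewriting under the sums.\<close>

lemma bilinear_extension_nest_left:
  "bilinear_extension f (bilinear_extension g a b) c =
    linear_extension free_scale (\<lambda>x. linear_extension free_scale
      (\<lambda>y. free_map (f (g x y)) c) b) a"
  by (simp add: bilinear_extension_def free_map_def linear_extension_linear_extension
      free.vector_space_axioms)

lemma bilinear_extension_nest_right:
  "bilinear_extension f a (bilinear_extension g b c) =
    linear_extension free_scale (\<lambda>x. linear_extension free_scale
      (\<lambda>y. free_map (\<lambda>z. f x (g y z)) c) b) a"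
  by (simp add: bilinear_extension_def free_map_def linear_extension_linear_extension
      free.vector_space_axioms)


subsection \<open>Maps that are multilinear modulo a subspace\<close>

text \<open>Working modulo \<open>W\<close> lets one notion serve two purposes:
  \<open>W = {0}\<close> gives ordinary multilinear maps into a vector space, and \<open>W\<close> a
  span of relations gives multilinear maps into a tensor power, computed on representatives.\<close>

definition multilinear_modulo ::
    "('k::field \<Rightarrow> 'a::ab_group_add \<Rightarrow> 'a) \<Rightarrow> ('a \<Rightarrow> 'x) set \<Rightarrow>
      ('k \<Rightarrow> 'b::ab_group_add \<Rightarrow> 'b) \<Rightarrow> 'b set \<Rightarrow> ('x \<Rightarrow> 'b) \<Rightarrow> bool"
  where "multilinear_modulo s slots t W f \<longleftrightarrow> (\<forall>i\<in>slots.
    (\<forall>a b. f (i (a + b)) - f (i a) - f (i b) \<in> W) \<and> (\<forall>c a. f (i (s c a)) - t c (f (i a)) \<in> W))"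

text \<open>This is the universal property of the tensor power: the preimage of \<open>W\<close>
  under the linear extension is a subspace, and multilinearity modulo \<open>W\<close> says
  precisely that it contains the generating relations.\<close>

lemma linear_extension_relations:
  assumes "vector_space t" "module.subspace t W" "multilinear_modulo s slots t W f"
    and "r \<in> free.span (multilinear_relations s slots)"
  shows "linear_extension t f r \<in> W"
proof -
  interpret t: vector_space t by fact
  let ?V = "{r. linear_extension t f r \<in> W}"
  have "free.subspace ?V"
    using t.subspace_0 assms(2)
    by (auto simp: free.subspace_def t.linear_extension_add t.linear_extension_scale
        t.subspace_add t.subspace_scale linear_extension_def[of _ _ 0])
  moreover have "multilinear_relations s slots \<subseteq> ?V"
    using assms(3)
    by (auto simp: multilinear_relations_def multilinear_modulo_def t.linear_extension_diff
        t.linear_extension_scale)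
  ultimately show ?thesis
    using free.span_minimal assms(4) by blast
qed

lemma tensor_class_eqI:
  assumes "p - q \<in> free.span (multilinear_relations s slots)"
  shows "tensor_class s slots p = tensor_class s slots q"
proof -
  have "r - p \<in> free.span (multilinear_relations s slots) \<longleftrightarrow>
      r - q \<in> free.span (multilinear_relations s slots)" for r
    using free.span_add[OF _ assms, of "r - p"] free.span_diff[OF _ assms, of "r - q"]
    by auto
  then show ?thesis by (simp add: tensor_class_def)
qed

abbreviation slots2 :: "('a \<Rightarrow> 'a \<times> 'a) set"
  where "slots2 \<equiv> Set.range (\<lambda>b a. (a, b)) \<union> Set.range (\<lambda>a b. (a, b))"

abbreviation slots3 :: "('a \<Rightarrow> 'a \<times> 'a \<times> 'a) set"
  where "slots3 \<equiv> {\<lambda>a. (a, b, c) | b c. True} \<union> {\<lambda>b. (a, b, c) | a c. True} \<union>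
    {\<lambda>c. (a, b, c) | a b. True}"

abbreviation span2 :: "('k::field \<Rightarrow> 'a::ab_group_add \<Rightarrow> 'a) \<Rightarrow> ('a \<times> 'a \<Rightarrow>\<^sub>0 'k) set"
  where "span2 s \<equiv> free.span (multilinear_relations s slots2)"

abbreviation span3 :: "('k::field \<Rightarrow> 'a::ab_group_add \<Rightarrow> 'a) \<Rightarrow> ('a \<times> 'a \<times> 'a \<Rightarrow>\<^sub>0 'k) set"
  where "span3 s \<equiv> free.span (multilinear_relations s slots3)"

lemma relation_add:
  "i \<in> slots \<Longrightarrow> gen (i (a + b)) - gen (i a) - gen (i b) \<in> free.span (multilinear_relations s slots)"
  unfolding multilinear_relations_def by (rule free.span_base) blast

lemma relation_scale:
  "i \<in> slots \<Longrightarrow> gen (i (s c a)) - free_scale c (gen (i a)) \<in> free.span (multilinear_relations s slots)"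
  unfolding multilinear_relations_def by (rule free.span_base) blast

text \<open>If \<open>h\<close> turns slots into slots, it turns defining relations into defining
  relations. This covers the identity, the swap of two factors and the insertion of a further
  factor.\<close>

lemma multilinear_modulo_gen:
  assumes "\<And>i. i \<in> slots \<Longrightarrow> (\<lambda>a. h (i a)) \<in> slots'"
  shows "multilinear_modulo s slots free_scale (free.span (multilinear_relations s slots'))
    (\<lambda>x. gen (h x))"
  unfolding multilinear_modulo_def
  using relation_add[OF assms] relation_scale[OF assms] by blast

lemma multilinear_modulo_slots2:
  "multilinear_modulo s slots2 t W f \<longleftrightarrow>
    (\<forall>a b y. f (a + b, y) - f (a, y) - f (b, y) \<in> W) \<and>
    (\<forall>c a y. f (s c a, y) - t c (f (a, y)) \<in> W) \<and>
    (\<forall>a b x. f (x, a + b) - f (x, a) - f (x, b) \<in> W) \<and>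
    (\<forall>c a x. f (x, s c a) - t c (f (x, a)) \<in> W)"
  by (simp add: multilinear_modulo_def ball_Un) blast

text \<open>This makes the tensor product of two linear maps well defined: linearity of
  \<open>g\<close> and \<open>h\<close> moves sums and scalars into the entries, where the relations
  of the target apply.\<close>

lemma multilinear_modulo_gen2:
  assumes "Vector_Spaces.linear s s' g" "Vector_Spaces.linear s s' h"
  shows "multilinear_modulo s slots2 free_scale (span2 s') (\<lambda>(x, y). gen (g x, h y))"
proof -
  interpret g: Vector_Spaces.linear s s' g by fact
  interpret h: Vector_Spaces.linear s s' h by fact
  have "multilinear_modulo s' slots2 free_scale (span2 s') (\<lambda>x. gen x)"
    by (rule multilinear_modulo_gen[where h = "\<lambda>x. x"])
  then show ?thesis
    by (simp add: multilinear_modulo_slots2 g.add g.scale h.add h.scale)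
qed

lemma multilinear_modulo_linear_extension:
  assumes "vector_space t" "module.subspace t W"
    and "\<And>y. multilinear_modulo s slots t W (\<lambda>x. F x y)"
  shows "multilinear_modulo s slots t W (\<lambda>x. linear_extension t (F x) q)"
proof -
  interpret t: vector_space t by fact
  show ?thesis
    using assms(3) unfolding multilinear_modulo_def
    by (auto simp flip: t.linear_extension_diff_fun t.linear_extension_scale_fun
        intro!: t.linear_extension_in_subspace[OF assms(2)])
qed


subsection \<open>The grouplike comultiplication\<close>

lemma mem_grouplike_Delta:
  "p \<in> grouplike_Delta a \<longleftrightarrow> p - free_map (\<lambda>x. (gen x, gen x)) a \<in> span2 free_scale"
  by (simp add: grouplike_Delta_def tensor2_def tensor_class_def)

text \<open>The representative \<open>p\<close> differs from the diagonal one \<open>?d\<close> by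
  relations, which \<open>f\<close> sends into \<open>W\<close>. On \<open>?d\<close> both sides are
  extensions from the basis, so comparing \<open>f\<close> with \<open>g\<close> on basis vectors
  suffices.\<close>

lemma grouplike_Delta_eval:
  assumes "vector_space t" "module.subspace t W" "multilinear_modulo free_scale slots2 t W f"
    and "Vector_Spaces.linear free_scale t g" "\<And>x. f (gen x, gen x) - g (gen x) \<in> W"
    and "p \<in> grouplike_Delta a"
  shows "linear_extension t f p - g a \<in> W"
proof -
  interpret t: vector_space t by fact
  let ?d = "free_map (\<lambda>x. (gen x, gen x)) a"
  have "linear_extension t f (p - ?d) \<in> W"
    using linear_extension_relations[OF assms(1-3)] assms(6) by (simp add: mem_grouplike_Delta)
  moreover have "linear_extension t f ?d - g a \<in> W"
    unfolding linear_eq_linear_extension[OF assms(4), of a] free_map_def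
      linear_extension_linear_extension[OF assms(1)] t.linear_extension_gen
      t.linear_extension_diff_fun[symmetric]
    by (intro t.linear_extension_in_subspace assms)
  ultimately show ?thesis
    using t.subspace_add[OF assms(2)] by (fastforce simp: t.linear_extension_diff)
qed

lemma grouplike_Delta_eval_eq:
  assumes "vector_space t" "multilinear_modulo free_scale slots2 t {0} f"
    and "Vector_Spaces.linear free_scale t g" "\<And>x. f (gen x, gen x) = g (gen x)"
    and "p \<in> grouplike_Delta a"
  shows "linear_extension t f p = g a"
proof -
  interpret t: vector_space t by fact
  show ?thesis
    using grouplike_Delta_eval[OF assms(1) t.subspace_single_0 assms(2,3) _ assms(5)] assms(4)
    by simp
qed

lemma grouplike_epsilon_gen [simp]: "grouplike_epsilon (gen x) = 1"
  by (simp add: grouplike_epsilon_def vector_space.linear_extension_gen[OF vector_space_times])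

lemma linear_grouplike_epsilon: "Vector_Spaces.linear free_scale (*) grouplike_epsilon"
  unfolding grouplike_epsilon_def
  by (rule vector_space.linear_linear_extension[OF vector_space_times])

lemma grouplike_Delta_add:
  assumes "p \<in> grouplike_Delta a" "q \<in> grouplike_Delta b"
  shows "p + q \<in> grouplike_Delta (a + b)"
  using free.span_add[OF assms[unfolded mem_grouplike_Delta]]
  by (simp add: mem_grouplike_Delta free_map_def free.linear_extension_add algebra_simps)

lemma grouplike_Delta_scale:
  assumes "p \<in> grouplike_Delta a"
  shows "free_scale c p \<in> grouplike_Delta (free_scale c a)"
  using free.span_scale[OF assms[unfolded mem_grouplike_Delta], of c]
  by (simp add: mem_grouplike_Delta free_map_def free.linear_extension_scale
      free.scale_right_diff_distrib)

section \<open>Coassociativity\<close>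

lemma grouplike_Delta_diff:
  assumes "p \<in> grouplike_Delta a" "q \<in> grouplike_Delta a"
  shows "p - q \<in> span2 free_scale"
  using free.span_diff[OF assms[unfolded mem_grouplike_Delta]] by simp

text \<open>Here \<open>\<iota> y\<close> places \<open>y\<close> next to a pair. An arbitrary
  choice \<delta> of representatives is linear only modulo \<open>span2\<close>, which suffices
  because insertion carries \<open>span2\<close> into \<open>span3\<close>. The two conclusions
  differ in which entry is expanded by \<delta>.\<close>

lemma multilinear_modulo_insert:
  assumes \<delta>: "\<And>x. \<delta> x \<in> grouplike_Delta x"
    and \<iota>: "\<And>y i. i \<in> slots2 \<Longrightarrow> (\<lambda>a. \<iota> y (i a)) \<in> slots3" "\<And>u. (\<lambda>y. \<iota> y u) \<in> slots3"
  shows "multilinear_modulo free_scale slots2 free_scale (span3 free_scale)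
      (\<lambda>(x, y). free_map (\<iota> y) (\<delta> x))" (is ?A)
    and "multilinear_modulo free_scale slots2 free_scale (span3 free_scale)
      (\<lambda>(y, x). free_map (\<iota> y) (\<delta> x))" (is ?B)
proof -
  have push: "free_map (\<iota> y) r \<in> span3 free_scale" if "r \<in> span2 free_scale" for y r
    unfolding free_map_def
    by (rule linear_extension_relations[OF free.vector_space_axioms free.subspace_span
          multilinear_modulo_gen[OF \<iota>(1)] that])
  have x: "free_map (\<iota> y) (\<delta> (a + b)) - free_map (\<iota> y) (\<delta> a) - free_map (\<iota> y) (\<delta> b)
      \<in> span3 free_scale" for y a b
    using push[OF grouplike_Delta_diff[OF \<delta>[of "a + b"] grouplike_Delta_add[OF \<delta>[of a] \<delta>[of b]]]]
    by (simp add: free_map_def free.linear_extension_diff free.linear_extension_add algebra_simps)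
  have x': "free_map (\<iota> y) (\<delta> (free_scale c a)) - free_scale c (free_map (\<iota> y) (\<delta> a))
      \<in> span3 free_scale" for y c a
    using push[OF grouplike_Delta_diff[OF \<delta>[of "free_scale c a"] grouplike_Delta_scale[OF \<delta>[of a]]]]
    by (simp add: free_map_def free.linear_extension_diff free.linear_extension_scale)
  \<comment> \<open>Additivity in the inserted entry holds term by term: for each fixed pair,
    varying that entry is itself a slot of the triple tensor.\<close>
  have y: "free_map (\<iota> (a + b)) r - free_map (\<iota> a) r - free_map (\<iota> b) r \<in> span3 free_scale" for a b r
    unfolding free_map_def free.linear_extension_diff_fun[symmetric]
    by (intro free.linear_extension_in_subspace free.subspace_span relation_add \<iota>(2))
  have y': "free_map (\<iota> (free_scale c a)) r - free_scale c (free_map (\<iota> a) r) \<in> span3 free_scale"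
    for c a r
    unfolding free_map_def free.linear_extension_diff_fun[symmetric]
      free.linear_extension_scale_fun[symmetric]
    by (intro free.linear_extension_in_subspace free.subspace_span relation_scale \<iota>(2))
  show ?A ?B
    unfolding multilinear_modulo_slots2 prod.case using x x' y y' by blast+
qed

text \<open>Modulo \<open>span3\<close> both iterated comultiplications equal the extension of the
  triple diagonal, \<open>?h a\<close>.\<close>

lemma grouplike_Delta_coassociative:
  assumes \<delta>: "\<And>x. \<delta> x \<in> grouplike_Delta x" and p: "p \<in> grouplike_Delta a"
  shows "linear_extension free_scale (\<lambda>(x, y). free_map (\<lambda>(u, v). (u, v, y)) (\<delta> x)) p -
      linear_extension free_scale (\<lambda>(x, y). free_map (\<lambda>(u, v). (x, u, v)) (\<delta> y)) p
      \<in> span3 free_scale"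
    (is "linear_extension _ ?f p - linear_extension _ ?g p \<in> ?W")
proof -
  let ?h = "free_map (\<lambda>x. (gen x, gen x, gen x))"
  have f: "multilinear_modulo free_scale slots2 free_scale ?W ?f"
    by (rule multilinear_modulo_insert(1)[where \<iota> = "\<lambda>y (u, v). (u, v, y)"]) (auto simp: \<delta>)
  have g: "multilinear_modulo free_scale slots2 free_scale ?W ?g"
    by (rule multilinear_modulo_insert(2)[where \<iota> = "\<lambda>x (u, v). (x, u, v)"]) (auto simp: \<delta>)
  \<comment> \<open>The chosen \<open>\<delta> (gen x)\<close> need not be the diagonal pair, but it
    is congruent to it modulo \<open>span2\<close>; inserting a third entry preserves the
    congruence.\<close>
  have ins: "free_map k (\<delta> (gen x)) - gen (k (gen x, gen x)) \<in> ?W"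
    if "\<And>i. i \<in> slots2 \<Longrightarrow> (\<lambda>a. k (i a)) \<in> slots3" for k x
  proof -
    have "linear_extension free_scale (\<lambda>y. gen (k y)) (\<delta> (gen x) - gen (gen x, gen x)) \<in> ?W"
      by (rule linear_extension_relations[OF _ _ multilinear_modulo_gen[OF that]])
        (use \<delta>[of "gen x"] in \<open>auto simp: free.vector_space_axioms free.subspace_span
          mem_grouplike_Delta\<close>)
    then show ?thesis
      by (simp add: free_map_def free.linear_extension_diff)
  qed
  have "free_map (\<lambda>(u, v). (u, v, y)) (\<delta> (gen x)) - gen (gen x, gen x, y) \<in> ?W" for x y
  proof -
    have "(\<lambda>a. (\<lambda>(u, v). (u, v, y)) (i a)) \<in> slots3" if "i \<in> slots2" for i
      using that by auto
    from ins[of "\<lambda>(u, v). (u, v, y)", OF this] show ?thesis by simp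
  qed
  then have "linear_extension free_scale ?f p - ?h a \<in> ?W"
    by (intro grouplike_Delta_eval[OF free.vector_space_axioms free.subspace_span f linear_free_map _ p])
      simp
  moreover have "free_map (\<lambda>(u, v). (y, u, v)) (\<delta> (gen x)) - gen (y, gen x, gen x) \<in> ?W" for x y
  proof -
    have "(\<lambda>a. (\<lambda>(u, v). (y, u, v)) (i a)) \<in> slots3" if "i \<in> slots2" for i
      using that by auto
    from ins[of "\<lambda>(u, v). (y, u, v)", OF this] show ?thesis by simp
  qed
  then have "linear_extension free_scale ?g p - ?h a \<in> ?W"
    by (intro grouplike_Delta_eval[OF free.vector_space_axioms free.subspace_span g linear_free_map _ p])
      simp
  ultimately show ?thesis
    using free.span_diff by fastforce
qed

lemma cocommutative_coalgebra_grouplike: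
  "cocommutative_coalgebra free_scale grouplike_Delta grouplike_epsilon"
proof (intro cocommutative_coalgebra.intro coalgebra.intro coalgebra_axioms.intro
    cocommutative_coalgebra_axioms.intro free.vector_space_axioms)
  interpret \<epsilon>: Vector_Spaces.linear free_scale "(*)" grouplike_epsilon
    by (rule linear_grouplike_epsilon)
  fix a b :: "'b \<Rightarrow>\<^sub>0 'a" and p q c
  show "grouplike_Delta a \<in> Set.range (tensor2 free_scale)"
    by (simp add: grouplike_Delta_def)
  show "p + q \<in> grouplike_Delta (a + b)" if "p \<in> grouplike_Delta a" "q \<in> grouplike_Delta b"
    using that by (rule grouplike_Delta_add)
  show "free_scale c p \<in> grouplike_Delta (free_scale c a)" if "p \<in> grouplike_Delta a"
    using that by (rule grouplike_Delta_scale)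
  show "Vector_Spaces.linear free_scale (*) grouplike_epsilon"
    by (rule linear_grouplike_epsilon)
  show "tensor3 free_scale
      (linear_extension free_scale (\<lambda>(x, y). free_map (\<lambda>(u, v). (u, v, y)) (\<delta> x)) p) =
    tensor3 free_scale
      (linear_extension free_scale (\<lambda>(x, y). free_map (\<lambda>(u, v). (x, u, v)) (\<delta> y)) p)"
    if "\<And>x. \<delta> x \<in> grouplike_Delta x" "p \<in> grouplike_Delta a" for \<delta>
    unfolding tensor3_def
    by (intro tensor_class_eqI grouplike_Delta_coassociative) (rule that)+
  show "linear_extension free_scale (\<lambda>(x, y). free_scale (grouplike_epsilon x) y) p = a"
    if "p \<in> grouplike_Delta a"
    \<comment> \<open>The comparison map is the identity: on a diagonal pair the scalar is 1 and the
      remaining factor is the basis vector itself.\<close>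
    by (rule grouplike_Delta_eval_eq[OF free.vector_space_axioms _ free.linear_ident _ that])
      (auto simp: multilinear_modulo_slots2 \<epsilon>.add \<epsilon>.scale free.scale_left_distrib
        free.scale_right_distrib mult.commute)
  show "linear_extension free_scale (\<lambda>(x, y). free_scale (grouplike_epsilon y) x) p = a"
    if "p \<in> grouplike_Delta a"
    by (rule grouplike_Delta_eval_eq[OF free.vector_space_axioms _ free.linear_ident _ that])
      (auto simp: multilinear_modulo_slots2 \<epsilon>.add \<epsilon>.scale free.scale_left_distrib
        free.scale_right_distrib mult.commute)
  show "free_map (\<lambda>(x, y). (y, x)) p \<in> grouplike_Delta a" if "p \<in> grouplike_Delta a"
    \<comment> \<open>Only the swap is unfolded, so that the diagonal map stays available as the
      linear comparison map. The swap exchanges the two kinds of slots and fixes diagonal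
      pairs.\<close>
    unfolding mem_grouplike_Delta free_map_def[of "\<lambda>(x, y). (y, x)"]
    by (rule grouplike_Delta_eval[OF free.vector_space_axioms free.subspace_span _ linear_free_map _ that])
      (auto simp: free.span_zero intro!: multilinear_modulo_gen)
qed

section \<open>Coalgebra morphisms induced by maps and operations on the basis\<close>

text \<open>Any map of the basis set works, since it sends grouplike basis vectors to grouplike
  basis vectors; the antipode is the case of the inverse map.\<close>

lemma coalgebra_endomorphism_free_map:
  "coalgebra_endomorphism free_scale grouplike_Delta grouplike_epsilon (free_map f)"
  unfolding coalgebra_endomorphism_def
proof (intro conjI allI ballI)
  show "Vector_Spaces.linear free_scale free_scale (free_map f)"
    by (rule linear_free_map)
  fix a and p
  show "grouplike_epsilon (free_map f a) = grouplike_epsilon a"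
    by (simp add: grouplike_epsilon_def free_map_def vector_space_times
        linear_extension_linear_extension vector_space.linear_extension_gen[OF vector_space_times])
  assume p: "p \<in> grouplike_Delta a"
  let ?g = "\<lambda>a. free_map (\<lambda>x. (gen x, gen x)) (free_map f a)"
  have "Vector_Spaces.linear free_scale free_scale ?g"
    by (rule Vector_Spaces.linear_compose[OF linear_free_map linear_free_map, unfolded o_def])
  moreover have "multilinear_modulo free_scale slots2 free_scale (span2 free_scale)
      (\<lambda>x. gen (map_prod (free_map f) (free_map f) x))"
    using multilinear_modulo_gen2[OF linear_free_map[of f] linear_free_map[of f]]
    by (simp add: map_prod_def case_prod_beta')
  ultimately show "free_map (map_prod (free_map f) (free_map f)) p \<in> grouplike_Delta (free_map f a)"
    unfolding mem_grouplike_Delta free_map_def[of "map_prod _ _"]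
    using p by (intro grouplike_Delta_eval[where g = ?g])
      (auto simp: free.vector_space_axioms free.subspace_span free.span_zero)
qed

text \<open>No law on \<open>f\<close> enters: a product of basis vectors is again a basis vector,
  hence grouplike. The comultiplications are evaluated one at a time, first at \<open>q\<close> and
  then at \<open>p\<close>.\<close>

lemma coalgebra_product_bilinear_extension:
  "coalgebra_product grouplike_Delta grouplike_epsilon (bilinear_extension f)"
  unfolding coalgebra_product_def
proof (intro conjI allI ballI)
  fix a b and p q
  let ?m = "bilinear_extension f"
  let ?d = "free_map (\<lambda>x. (gen x, gen x))"
  let ?F = "\<lambda>(a\<^sub>1, a\<^sub>2) (b\<^sub>1, b\<^sub>2). (?m a\<^sub>1 b\<^sub>1, ?m a\<^sub>2 b\<^sub>2)"
  \<comment> \<open>The inner sum over \<open>b\<close> does not depend on \<open>x\<close>. The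
    factor 1 is kept so that the constant can be pulled out by
    \<open>linear_extension_scale_fun\<close>.\<close>
  have "grouplike_epsilon (?m a b) =
      linear_extension (*) (\<lambda>x. grouplike_epsilon b * 1) a"
    by (simp add: grouplike_epsilon_def bilinear_extension_def free_map_def vector_space_times
        linear_extension_linear_extension vector_space.linear_extension_gen[OF vector_space_times])
  also have "\<dots> = grouplike_epsilon a * grouplike_epsilon b"
    unfolding vector_space.linear_extension_scale_fun[OF vector_space_times]
    by (simp add: grouplike_epsilon_def)
  finally show "grouplike_epsilon (?m a b) = grouplike_epsilon a * grouplike_epsilon b" .
  assume p: "p \<in> grouplike_Delta a" and q: "q \<in> grouplike_Delta b"
  \<comment> \<open>With the left argument fixed at a diagonal pair, this evaluates the
    comultiplication of \<open>b\<close>; it supplies the comparison on basis vectors when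
    \<open>p\<close> is evaluated below.\<close>
  have "free_map (?F (gen x, gen x)) q - ?d (?m (gen x) b) \<in> span2 free_scale" for x
  proof -
    have 1: "multilinear_modulo free_scale slots2 free_scale (span2 free_scale)
        (\<lambda>y. gen (?F (gen x, gen x) y))"
      using multilinear_modulo_gen2[OF linear_free_map[of "f x"] linear_free_map[of "f x"]]
      by (simp add: case_prod_beta')
    have 2: "Vector_Spaces.linear free_scale free_scale (\<lambda>b. ?d (?m (gen x) b))"
      by (rule Vector_Spaces.linear_compose[OF bilinear_extension_linear_right linear_free_map,
            unfolded o_def])
    show ?thesis
      unfolding free_map_def[of "?F _"]
      by (rule grouplike_Delta_eval[OF free.vector_space_axioms free.subspace_span 1 2 _ q])
        (simp add: free.span_zero)
  qed
  moreover have "multilinear_modulo free_scale slots2 free_scale (span2 free_scale)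
      (\<lambda>x. free_map (?F x) q)"
    unfolding free_map_def
    using multilinear_modulo_gen2[OF bilinear_extension_linear_left bilinear_extension_linear_left]
    by (intro multilinear_modulo_linear_extension)
      (simp_all add: free.vector_space_axioms free.subspace_span case_prod_beta')
  moreover have "Vector_Spaces.linear free_scale free_scale (\<lambda>a. ?d (?m a b))"
    by (rule Vector_Spaces.linear_compose[OF bilinear_extension_linear_left linear_free_map,
          unfolded o_def])
  ultimately show "bilinear_extension ?F p q \<in> grouplike_Delta (?m a b)"
    unfolding mem_grouplike_Delta bilinear_extension_def[of ?F]
    using p by (intro grouplike_Delta_eval[where g = "\<lambda>a. ?d (?m a b)"])
      (auto simp: free.vector_space_axioms free.subspace_span)
qed

text \<open>This is the convolution of \<open>S\<close> and \<open>T\<close>. With one of them the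
  identity and the other the antipode it gives both antipode axioms, where the hypothesis on basis
  vectors is the inverse law of the digroup.\<close>

lemma grouplike_Delta_convolution:
  assumes "Vector_Spaces.linear free_scale free_scale S"
    and "Vector_Spaces.linear free_scale free_scale T"
    and "\<And>x. bilinear_extension f (S (gen x)) (T (gen x)) = e"
    and "p \<in> grouplike_Delta a"
  shows "linear_extension free_scale (\<lambda>(a\<^sub>1, a\<^sub>2). bilinear_extension f (S a\<^sub>1) (T a\<^sub>2)) p =
    free_scale (grouplike_epsilon a) e"
proof (rule grouplike_Delta_eval_eq[OF free.vector_space_axioms _ _ _ assms(4)])
  interpret S: Vector_Spaces.linear free_scale free_scale S by fact
  interpret T: Vector_Spaces.linear free_scale free_scale T by fact
  interpret l: Vector_Spaces.linear free_scale free_scale "\<lambda>a. bilinear_extension f a b" for b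
    by (rule bilinear_extension_linear_left)
  interpret r: Vector_Spaces.linear free_scale free_scale "bilinear_extension f a" for a
    by (rule bilinear_extension_linear_right)
  interpret \<epsilon>: Vector_Spaces.linear free_scale "(*)" grouplike_epsilon
    by (rule linear_grouplike_epsilon)
  show "multilinear_modulo free_scale slots2 free_scale {0}
      (\<lambda>(a\<^sub>1, a\<^sub>2). bilinear_extension f (S a\<^sub>1) (T a\<^sub>2))"
    by (simp add: multilinear_modulo_slots2 S.add S.scale T.add T.scale l.add l.scale r.add r.scale)
  show "Vector_Spaces.linear free_scale free_scale (\<lambda>a. free_scale (grouplike_epsilon a) e)"
    by (simp add: Vector_Spaces.linear_iff free.vector_space_axioms \<epsilon>.add \<epsilon>.scale
        free.scale_left_distrib)
qed (simp add: assms(3))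


subsection \<open>The Hopf dialgebra of a digroup\<close>

text \<open>Write \<xi> as \<open>inv_map x \<stileturn> x\<close> on the left-hand side,
  reassociate by \<open>mixed_assoc\<close>, and collapse \<open>x \<turnstile> inv_map x\<close> to
  \<xi>.\<close>

lemma (in digroup) lprod_bar_unit: "x \<turnstile> \<xi> = \<xi> \<stileturn> x"
  by (metis mixed_assoc lprod_inv rprod_inv)

theorem proposition5p9:
  fixes lprod rprod :: "'d \<Rightarrow> 'd \<Rightarrow> 'd"
    and \<xi> :: 'd
    and inv_map :: "'d \<Rightarrow> 'd"
  assumes "digroup lprod rprod \<xi> inv_map"
  shows "cocommutative_hopf_dialgebra
    (free_scale :: 'k::field_char_0 \<Rightarrow> ('d \<Rightarrow>\<^sub>0 'k) \<Rightarrow> ('d \<Rightarrow>\<^sub>0 'k))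
    grouplike_Delta
    grouplike_epsilon
    (gen \<xi>)
    (bilinear_extension lprod)
    (bilinear_extension rprod)
    (free_map inv_map)"
proof -
  interpret D: digroup lprod rprod \<xi> inv_map by fact
  have unit: "lprod \<xi> x = x" "rprod x \<xi> = x" for x
    using D.bar_unit_xi by (simp_all add: bar_unit_def)
  note nest = bilinear_extension_nest_left bilinear_extension_nest_right free_map_def
  show ?thesis
  proof (intro cocommutative_hopf_dialgebra.intro cocommutative_coalgebra_grouplike
      cocommutative_hopf_dialgebra_axioms.intro bilinear_product_bilinear_extension
      coalgebra_endomorphism_free_map coalgebra_product_bilinear_extension)
    fix a b c :: "'d \<Rightarrow>\<^sub>0 'k" and p
    let ?l = "bilinear_extension lprod" and ?r = "bilinear_extension rprod"
    show "?l (?l a b) c = ?l a (?l b c)"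
      by (simp add: nest D.lprod_assoc)
    show "?r (?r a b) c = ?r a (?r b c)"
      by (simp add: nest D.rprod_assoc)
    show "?l (?l a b) c = ?l (?r a b) c"
      by (simp add: nest D.left_bar)
    show "?r a (?r b c) = ?r a (?l b c)"
      by (simp add: nest D.right_bar)
    show "?r (?l a b) c = ?l a (?r b c)"
      by (simp add: nest D.mixed_assoc)
    show "?l (gen \<xi>) a = a"
      by (simp add: unit free_map_def)
    show "?r a (gen \<xi>) = a"
      by (simp add: bilinear_extension_def unit)
    show "?l a (gen \<xi>) = ?r (gen \<xi>) a"
      \<comment> \<open>Only the \<open>lprod\<close> side needs unfolding; on the
        \<open>rprod\<close> side a basis vector stands on the left, so
        \<open>bilinear_extension_gen_left\<close> applies.\<close>
      by (simp add: bilinear_extension_def[of lprod] D.lprod_bar_unit) (simp add: free_map_def)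
    show "grouplike_Delta (gen \<xi> :: 'd \<Rightarrow>\<^sub>0 'k) = tensor2 free_scale (gen (gen \<xi>, gen \<xi>))"
      by (simp add: grouplike_Delta_def)
    show "grouplike_epsilon (gen \<xi> :: 'd \<Rightarrow>\<^sub>0 'k) = 1"
      by simp
    assume p: "p \<in> grouplike_Delta a"
    show "linear_extension free_scale (\<lambda>(a\<^sub>1, a\<^sub>2). ?l a\<^sub>1 (free_map inv_map a\<^sub>2)) p =
        free_scale (grouplike_epsilon a) (gen \<xi>)"
      by (rule grouplike_Delta_convolution[OF free.linear_ident linear_free_map _ p])
        (simp add: D.lprod_inv)
    show "linear_extension free_scale (\<lambda>(a\<^sub>1, a\<^sub>2). ?r (free_map inv_map a\<^sub>1) a\<^sub>2) p =
        free_scale (grouplike_epsilon a) (gen \<xi>)"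
      by (rule grouplike_Delta_convolution[OF linear_free_map free.linear_ident _ p])
        (simp add: D.rprod_inv)
  qed
qed

end
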